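(* Let $(a_n)_{n\ge1}$ be the Hofstadter consecutive-sum sequence. For every $\varepsilon>0$ there exists $C_\varepsilon>0$ such that, for all $n\ge1$, \[ a_n\le C_\varepsilon\,n^{4175/2506+\varepsilon}. \]
   Context: The Hofstadter consecutive-sum sequence $(a_n)_{n\ge1}$ is the strictly increasing integer sequence defined by $a_1=1$, $a_2=2$, and, for $k\ge3$, by taking $a_k$ to be the least integer greater than $a_{k-1}$ that can be written as $\sum_{i=p}^{q}a_i$ for some integers $1\le p<q\le k-1$ (a sum of at least two consecutive earlier terms). *)

theory Defs
  imports "HOL-Analysis.Analysis"
begin

text \<open>
  The sequence starts at index 1; the value 0 at index 0 is a dummy and never enters a sum,
  since \<open>p \<ge> 1\<close>. All terms are positive integers, so natural numbers suffice as values.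
\<close>

context
  notes conj_cong [fundef_cong]
begin

function hofstadter :: "nat \<Rightarrow> nat" where
  "hofstadter k =
    (if k \<le> 2 then k
     else (LEAST m. hofstadter (k - 1) < m \<and>
            (\<exists>p q. 1 \<le> p \<and> p < q \<and> q \<le> k - 1 \<and> m = (\<Sum>i = p..q. hofstadter i))))"
  by pat_completeness auto
termination
  by (relation "Wellfounded.measure id") auto

end

declare hofstadter.simps [simp del]

lemma hofstadter_1 [simp]: "hofstadter (Suc 0) = 1"
  and hofstadter_2 [simp]: "hofstadter 2 = 2"
  by (simp_all add: hofstadter.simps)

lemma hofstadter_candidate:
  assumes "3 \<le> k" "0 < hofstadter (k - 2)"
  shows "\<exists>m. hofstadter (k - 1) < m \<and>
       (\<exists>p q. 1 \<le> p \<and> p < q \<and> q \<le> k - 1 \<and> m = (\<Sum>i = p..q. hofstadter i))"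
proof -
  have "{k - 2..k - 1} = {k - 2, k - 1}" "k - 2 \<noteq> k - 1" using assms(1) by auto
  then have "hofstadter (k - 2) + hofstadter (k - 1) = (\<Sum>i = k - 2..k - 1. hofstadter i)"
    by simp
  moreover have "1 \<le> k - 2" "k - 2 < k - 1" using assms(1) by auto
  moreover have "hofstadter (k - 1) < hofstadter (k - 2) + hofstadter (k - 1)"
    using assms(2) by simp
  ultimately show ?thesis by (metis order_refl)
qed

lemma hofstadter_pos: "1 \<le> k \<Longrightarrow> 0 < hofstadter k"
proof (induction k rule: less_induct)
  case (less k)
  show ?case
  proof (cases "3 \<le> k")
    case True
    then have "0 < hofstadter (k - 2)" using less.IH[of "k - 2"] by auto
    from LeastI_ex[OF hofstadter_candidate[OF True this]]
    have "hofstadter (k - 1) < hofstadter k"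
      using True by (subst (2) hofstadter.simps) auto
    then show ?thesis by simp
  next
    case False
    then show ?thesis using less.prems by (simp add: hofstadter.simps)
  qed
qed

text \<open>
  The minimum is always taken over a nonempty set, because \<open>a\<^bsub>k-2\<^esub> + a\<^bsub>k-1\<^esub> > a\<^bsub>k-1\<^esub>\<close>; so the
  recursion really produces the sequence with the defining property below.
\<close>

lemma hofstadter_step:
  assumes "3 \<le> k"
  shows "hofstadter (k - 1) < hofstadter k"
    and "\<exists>p q. 1 \<le> p \<and> p < q \<and> q \<le> k - 1 \<and> hofstadter k = (\<Sum>i = p..q. hofstadter i)"
    and "\<lbrakk>hofstadter (k - 1) < m; 1 \<le> p; p < q; q \<le> k - 1; m = (\<Sum>i = p..q. hofstadter i)\<rbrakk>
      \<Longrightarrow> hofstadter k \<le> m"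
proof -
  let ?P = "\<lambda>m. hofstadter (k - 1) < m \<and>
       (\<exists>p q. 1 \<le> p \<and> p < q \<and> q \<le> k - 1 \<and> m = (\<Sum>i = p..q. hofstadter i))"
  have eq: "hofstadter k = (LEAST m. ?P m)"
    using assms by (subst hofstadter.simps) simp
  have "0 < hofstadter (k - 2)"
    using assms by (intro hofstadter_pos) simp
  from LeastI_ex[OF hofstadter_candidate[OF assms this]]
  have P: "?P (hofstadter k)" unfolding eq .
  from P show "hofstadter (k - 1) < hofstadter k" by (rule conjunct1)
  from P show "\<exists>p q. 1 \<le> p \<and> p < q \<and> q \<le> k - 1 \<and> hofstadter k = (\<Sum>i = p..q. hofstadter i)"
    by (rule conjunct2)
  show "hofstadter k \<le> m"
    if "hofstadter (k - 1) < m" "1 \<le> p" "p < q" "q \<le> k - 1" "m = (\<Sum>i = p..q. hofstadter i)"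
  proof -
    have "?P m" using that by blast
    then show ?thesis unfolding eq by (rule Least_le)
  qed
qed

end

(*
  Write S_q = a_1 + ... + a_q. Every S_q - S_p with p < q is a term of the sequence. Let x = a_k,
  let S_(q+1) be the first partial sum above x and let p be maximal with S_p < S_(q+1) - x. Then
  S_(q+1) - S_p is a term above x, so the gap after x is at most a_(p+1), where S_p <= a_(q+1)
  and S_q <= x. Small gaps force large partial sums, so this bounds gaps by smaller gaps.

  If gaps are at most eta * x, then a_(q+1) <= eta * S_q + O(1), and the gap after x is at most
  eta^2 * x + O(1); starting from some eta < 1 this gives gaps o(x). If gaps are at most
  C * x^(1-s), then a_(q+1)^(1+s) = O(C * S_q), and the gap g after x satisfies
  g^((1+s)^2) = O(C^(2+s) * x). For s + s^2 < 1 this closes an induction, where the o(x) bound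
  covers the range in which x^s is not much larger than C. Summing the gaps, a_n = O(n^(1/s)).
  The limiting exponent is the golden ratio 1.618..., below 4175/2506 = 1.66600...
*)

theory Submission
  imports Defs
begin

section \<open>Partial sums and elementary growth\<close>

definition psum :: "nat \<Rightarrow> nat" where
  "psum q = (\<Sum>i = 1..q. hofstadter i)"

lemma psum_0 [simp]: "psum 0 = 0"
  by (simp add: psum_def)

lemma psum_Suc [simp]: "psum (Suc q) = psum q + hofstadter (Suc q)"
  by (simp add: psum_def)

lemma psum_split:
  assumes "p \<le> q"
  shows "psum p + (\<Sum>i = Suc p..q. hofstadter i) = psum q"
  using assms by (induction q) (auto simp: le_Suc_eq)

lemma hofstadter_less_Suc: "1 \<le> k \<Longrightarrow> hofstadter k < hofstadter (Suc k)"
  using hofstadter_step(1)[of "Suc k"] hofstadter_2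
  by (cases "k = 1") (auto simp: numeral_2_eq_2)

lemma hofstadter_mono: "1 \<le> i \<Longrightarrow> i \<le> j \<Longrightarrow> hofstadter i \<le> hofstadter j"
proof (induction j)
  case (Suc j)
  then show ?case using hofstadter_less_Suc[of j] by (cases "i = Suc j") auto
qed simp

lemma hofstadter_ge_index: "k \<le> hofstadter k"
proof (induction k)
  case (Suc k)
  then show ?case
    using hofstadter_less_Suc[of k] by (cases "k = 0") auto
qed simp

text \<open>If \<open>k < q\<close>, the difference contains a_q, which is at least a_(k+1). If
  \<open>q <= k\<close> and \<open>k >= 2\<close>, a single summand could not exceed a_k, so at
  least two earlier terms are summed and the difference competes in the minimum defining a_(k+1).
  For \<open>k = 1\<close> integrality suffices, as a_2 = 2.\<close>

lemma hofstadter_Suc_le_psum_diff: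
  assumes "1 \<le> k" "p < q" "hofstadter k + psum p < psum q"
  shows "hofstadter (Suc k) + psum p \<le> psum q"
proof -
  let ?m = "\<Sum>i = Suc p..q. hofstadter i"
  have m: "psum p + ?m = psum q" using psum_split assms(2) by simp
  have "hofstadter q \<le> ?m" using assms(2) by (intro member_le_sum) auto
  consider "k < q" | "q \<le> k" "k = 1" | "q \<le> k" "k \<ge> 2" using assms(1) by linarith
  then have "hofstadter (Suc k) \<le> ?m"
  proof cases
    case 1
    then show ?thesis
      using hofstadter_mono[of "Suc k" q] \<open>hofstadter q \<le> ?m\<close> by simp
  next
    case 2
    then show ?thesis using m assms(3) hofstadter_2 by (simp add: numeral_2_eq_2)
  next
    case 3
    have "Suc p \<noteq> q"
    proof
      assume "Suc p = q"
      then have "psum q = psum p + hofstadter q" by auto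
      then show False using hofstadter_mono[of q k] 3 assms by auto
    qed
    then show ?thesis
      using hofstadter_step(3)[of "Suc k" ?m "Suc p" q] 3 assms m by simp
  qed
  then show ?thesis using m by simp
qed

lemma hofstadter_Suc_le_double:
  assumes "1 \<le> k"
  shows "hofstadter (Suc k) \<le> 2 * hofstadter k"
proof (cases "k = 1")
  case True
  then show ?thesis using hofstadter_2 by (simp add: numeral_2_eq_2)
next
  case False
  then obtain j where k: "k = Suc (Suc j)"
    using assms by (metis One_nat_def not0_implies_Suc not_one_le_zero)
  \<comment> \<open>The sum of the last two terms, S_k - S_(k-2), exceeds a_k.\<close>
  show ?thesis
    using hofstadter_Suc_le_psum_diff[of k j k] hofstadter_mono[of "Suc j" k]
      hofstadter_pos[of "Suc j"] by (simp add: k)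
qed

section \<open>Bounding a gap by an earlier term\<close>

lemma hofstadter_gap:
  assumes "2 \<le> k"
  obtains p q where "p \<le> q" "q < k" "psum q \<le> hofstadter k" "psum p \<le> hofstadter (Suc q)"
    "hofstadter (Suc k) \<le> hofstadter k + hofstadter (Suc p)"
proof -
  obtain j where k: "k = Suc j" "1 \<le> j" using assms by (cases k) auto
  have "hofstadter j \<le> psum j" unfolding psum_def using k by (intro member_le_sum) auto
  \<comment> \<open>As \<open>k >= 2\<close>, a positive term precedes a_k, so the search for
    \<open>r\<close> stops by \<open>k\<close>. This yields \<open>q < k\<close>, on which the later
    strong induction relies.\<close>
  then have "hofstadter k < psum k" using k hofstadter_pos[of j] by simp
  define r where "r = (LEAST r. hofstadter k < psum r)"
  have r: "hofstadter k < psum r" "r \<le> k"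
    unfolding r_def using \<open>hofstadter k < psum k\<close> by (auto intro: LeastI Least_le)
  then obtain q where q: "r = Suc q" by (cases r) auto
  have qk: "psum q \<le> hofstadter k"
    using not_less_Least[of q "\<lambda>r. hofstadter k < psum r"] q r_def by simp
  \<comment> \<open>The minimal \<open>t\<close> is p + 1 for the maximal p. Minimality gives S_p <
    S_r - a_k <= a_(q+1), and the property of \<open>t\<close> itself bounds S_r - S_p - a_k by
    a_(p+1).\<close>
  define t where "t = (LEAST t. psum r \<le> hofstadter k + psum t)"
  have t: "psum r \<le> hofstadter k + psum t" "t \<le> r"
    unfolding t_def by (auto intro: LeastI[of _ r] Least_le)
  then obtain p where p: "t = Suc p" using r by (cases t) auto
  have pk: "hofstadter k + psum p < psum r"
    using not_less_Least[of p "\<lambda>t. psum r \<le> hofstadter k + psum t"] p t_def by simp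
  have "hofstadter (Suc k) + psum p \<le> psum r"
    using pk p t assms by (intro hofstadter_Suc_le_psum_diff) auto
  then show ?thesis
    using that[of p q] p q t r qk pk by auto
qed

section \<open>Gaps are o(x)\<close>

text \<open>The linear bound is used at p and then at q, linked by S_p <= a_(q+1) and S_q <= a_k;
  this squares the factor.\<close>

lemma hofstadter_gap_square:
  fixes \<eta> K :: real
  assumes "\<And>q. real (hofstadter (Suc q)) \<le> \<eta> * real (psum q) + K" "0 \<le> \<eta>" "2 \<le> k"
  shows "real (hofstadter (Suc k)) - real (hofstadter k) \<le> \<eta>\<^sup>2 * real (hofstadter k) + (1 + \<eta>) * K"
proof -
  obtain p q where pq: "psum q \<le> hofstadter k" "psum p \<le> hofstadter (Suc q)"
    "hofstadter (Suc k) \<le> hofstadter k + hofstadter (Suc p)"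
    using hofstadter_gap[OF assms(3)] by metis
  have "real (hofstadter (Suc k)) - real (hofstadter k) \<le> real (hofstadter (Suc p))"
    using pq(3) by linarith
  also have "\<dots> \<le> \<eta> * real (psum p) + K" by (rule assms(1))
  also have "\<dots> \<le> \<eta> * (\<eta> * real (psum q) + K) + K"
    using pq(2) assms(1)[of q] assms(2) by (intro add_right_mono mult_left_mono) auto
  also have "\<dots> \<le> \<eta> * (\<eta> * real (hofstadter k) + K) + K"
    using pq(1) assms(2) by (intro add_right_mono mult_left_mono) auto
  finally show ?thesis by (simp add: algebra_simps power2_eq_square)
qed

lemma eventually_le_hofstadter: "eventually (\<lambda>k. c \<le> real (hofstadter k)) sequentially"
proof -
  have "eventually (\<lambda>k. c \<le> real k) sequentially"
    using filterlim_real_sequentially by (simp add: filterlim_at_top)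
  then show ?thesis
    by eventually_elim (meson hofstadter_ge_index of_nat_mono order_trans)
qed

text \<open>The slack between the square and \<mu> absorbs the additive constant once a_k is
  large.\<close>

lemma eventually_gap_le_of_square:
  fixes \<eta> \<mu> K :: real
  assumes "\<And>q. real (hofstadter (Suc q)) \<le> \<eta> * real (psum q) + K" "0 \<le> \<eta>" "\<eta>\<^sup>2 < \<mu>"
  shows "eventually (\<lambda>k. real (hofstadter (Suc k)) - real (hofstadter k) \<le> \<mu> * real (hofstadter k)) sequentially"
  using eventually_le_hofstadter[of "(1 + \<eta>) * K / (\<mu> - \<eta>\<^sup>2)"] eventually_ge_at_top[of 2]
proof eventually_elim
  case (elim k)
  then have "(1 + \<eta>) * K \<le> real (hofstadter k) * (\<mu> - \<eta>\<^sup>2)"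
    using assms(3) by (simp add: divide_le_eq)
  then show ?case
    using hofstadter_gap_square[OF assms(1,2) elim(2)] by (simp add: algebra_simps)
qed

lemma hofstadter_Suc_le_psum:
  "real (hofstadter (Suc q)) \<le> 8/9 * real (psum q) + real (hofstadter 3)"
proof (cases "3 \<le> q")
  case True
  then obtain j where q: "q = Suc (Suc (Suc j))" by (metis Suc_le_D numeral_3_eq_3 Suc_le_mono)
  have "hofstadter (Suc q) \<le> hofstadter q + hofstadter (Suc (Suc j))"
    using hofstadter_Suc_le_psum_diff[of q "Suc j" q] hofstadter_pos[of "Suc (Suc j)"] q by simp
  moreover have "hofstadter (Suc q) \<le> 2 * hofstadter q" "hofstadter q \<le> 2 * hofstadter (Suc (Suc j))"
    "hofstadter (Suc (Suc j)) \<le> 2 * hofstadter (Suc j)"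
    using hofstadter_Suc_le_double q by auto
  \<comment> \<open>S_q is at least the sum of its last three terms: a_q + a_(q-1) >= a_(q+1), and
    three doublings give a_(q-2) >= a_(q+1)/8.\<close>
  ultimately have "9 * hofstadter (Suc q) \<le> 8 * psum q" using q by simp
  then show ?thesis by linarith
next
  case False
  then show ?thesis using hofstadter_mono[of "Suc q" 3] by simp
qed

text \<open>Telescoping the gaps from \<open>m\<close> on turns a gap bound back into the linear
  bound that the squaring step consumes; a_m accounts for the smaller indices.\<close>

lemma hofstadter_Suc_le_of_gap_le:
  fixes \<eta> :: real
  assumes "\<And>i. m \<le> i \<Longrightarrow> real (hofstadter (Suc i)) - real (hofstadter i) \<le> \<eta> * real (hofstadter i)"
    and "0 \<le> \<eta>" "1 \<le> m"
  shows "real (hofstadter (Suc q)) \<le> \<eta> * real (psum q) + real (hofstadter m)"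
proof (induction q)
  case 0
  then show ?case using hofstadter_mono[of 1 m] assms by simp
next
  case (Suc q)
  show ?case
  proof (cases "m \<le> Suc q")
    case True
    then show ?thesis using Suc assms(1)[of "Suc q"] by (simp add: algebra_simps)
  next
    case False
    then show ?thesis
      using hofstadter_mono[of "Suc (Suc q)" m] assms(2) by (simp add: add_increasing)
  qed
qed

lemma hofstadter_gap_small:
  fixes \<eta> :: real
  assumes "0 < \<eta>"
  shows "eventually (\<lambda>k. real (hofstadter (Suc k)) - real (hofstadter k) \<le> \<eta> * real (hofstadter k)) sequentially"
proof -
  \<comment> \<open>Squaring doubles the exponent e, and the strict inequality 2e > e + 1 that
    provides slack holds from e = 2 on. The start e = 2 uses (8/9)^2 < (9/10)^2.\<close>
  have *: "eventually (\<lambda>k. real (hofstadter (Suc k)) - real (hofstadter k) 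
      \<le> (9/10) ^ (n + 2) * real (hofstadter k)) sequentially" for n
  proof (induction n)
    case 0
    show ?case
      by (rule eventually_gap_le_of_square[OF hofstadter_Suc_le_psum]) (auto simp: power2_eq_square)
  next
    case (Suc n)
    then obtain m where m: "\<And>i. m \<le> i \<Longrightarrow> real (hofstadter (Suc i)) - real (hofstadter i)
      \<le> (9/10) ^ (n + 2) * real (hofstadter i)"
      unfolding eventually_sequentially by blast
    have K: "real (hofstadter (Suc q)) \<le> (9/10) ^ (n + 2) * real (psum q) + real (hofstadter (max 1 m))" for q
      using m by (intro hofstadter_Suc_le_of_gap_le) auto
    have "((9/10::real) ^ (n + 2))\<^sup>2 = (9/10) ^ (2 * (n + 2))" by (metis mult.commute power_mult)
    also have "\<dots> < (9/10) ^ (Suc n + 2)" by (intro power_strict_decreasing) auto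
    finally show ?case by (intro eventually_gap_le_of_square[OF K]) auto
  qed
  obtain n where n: "(9/10::real) ^ n < \<eta>" using real_arch_pow_inv[OF assms, of "9/10"] by auto
  have "(9/10::real) ^ (n + 2) \<le> (9/10) ^ n" by (intro power_decreasing) auto
  with n have "(9/10::real) ^ (n + 2) \<le> \<eta>" by linarith
  then show ?thesis
    using *[of n] by (elim eventually_mono) (meson mult_right_mono of_nat_0_le_iff order_trans)
qed

section \<open>Gaps with a power saving\<close>

text \<open>A gap of order x^(1-s) times a derivative of order x^s has order x, so the increments of
  a_i^(1+s) add up to a partial sum. Restricting the gap bound to \<open>i <= q\<close> makes this
  usable inside the strong induction on gaps.\<close>

lemma psum_ge_powr:
  fixes s C :: real
  assumes gap: "\<And>i. 1 \<le> i \<Longrightarrow> i \<le> q \<Longrightarrow>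
      real (hofstadter (Suc i)) - real (hofstadter i) \<le> C * real (hofstadter i) powr (1 - s)"
    and "0 < s" "s < 1" "0 \<le> C"
  shows "real (hofstadter (Suc q)) powr (1 + s) \<le> 4 * C * real (psum q) + 1"
  using gap
proof (induction q)
  case 0
  then show ?case by simp
next
  case (Suc q)
  define x where "x = real (hofstadter (Suc q))"
  define y where "y = real (hofstadter (Suc (Suc q)))"
  have x: "0 < x" "x < y" "y \<le> 2 * x"
    using hofstadter_pos[of "Suc q"] hofstadter_less_Suc[of "Suc q"] hofstadter_Suc_le_double[of "Suc q"]
    by (simp_all add: x_def y_def)
  have "\<exists>z>x. z < y \<and> y powr (1 + s) - x powr (1 + s) = (y - x) * ((1 + s) * z powr s)"
    using x by (intro MVT2) (auto intro!: derivative_eq_intros)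
  then obtain z where z: "x < z" "z < y"
    "y powr (1 + s) - x powr (1 + s) = (y - x) * ((1 + s) * z powr s)" by blast
  have "z powr s \<le> (2 * x) powr s" using x z assms by (intro powr_mono2) auto
  also have "\<dots> \<le> 2 * x powr s"
    using x assms powr_mono[of s 1 2] by (simp add: powr_mult)
  finally have "z powr s \<le> 2 * x powr s" .
  \<comment> \<open>The constant 4: one factor 2 bounds 1 + s, the other comes from z < 2x.\<close>
  then have zs: "(1 + s) * z powr s \<le> 2 * (2 * x powr s)"
    using assms by (intro mult_mono) auto
  have "y - x \<le> C * x powr (1 - s)" using Suc.prems[of "Suc q"] by (simp add: x_def y_def)
  then have "(y - x) * ((1 + s) * z powr s) \<le> (C * x powr (1 - s)) * (2 * (2 * x powr s))"
    using x assms by (intro mult_mono[OF _ zs]) auto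
  also have "\<dots> = 4 * C * (x powr (1 - s) * x powr s)" by simp
  also have "x powr (1 - s) * x powr s = x" using x by (simp flip: powr_add)
  finally have "y powr (1 + s) \<le> x powr (1 + s) + 4 * C * x" using z by simp
  moreover have "x powr (1 + s) \<le> 4 * C * real (psum q) + 1"
    unfolding x_def using Suc by simp
  ultimately show ?case by (simp add: x_def y_def algebra_simps)
qed

lemma hofstadter_gap_powr:
  fixes s :: real
  assumes "0 < s" "s + s\<^sup>2 < 1"
  obtains C where "1 \<le> C" "\<And>k. 1 \<le> k \<Longrightarrow>
    real (hofstadter (Suc k)) - real (hofstadter k) \<le> C * real (hofstadter k) powr (1 - s)"
proof -
  have "s < 1" using assms zero_le_power2[of s] by linarith
  define d where "d = 1 - s - s\<^sup>2"
  have "0 < d" using assms by (simp add: d_def)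
  \<comment> \<open>Then d * r = (2 + s) ln 5, the total cost of the constant 5 in two applications
    of \<open>psum_ge_powr\<close>. Since \<open>r\<close> does not involve \<open>C\<close>, first
    \<open>m\<close> and then \<open>C\<close> can depend on it.\<close>
  define r where "r = (2 + s) * ln 5 / d"
  obtain m where m: "\<And>k. m \<le> k \<Longrightarrow>
      real (hofstadter (Suc k)) - real (hofstadter k) \<le> exp (- r) * real (hofstadter k)"
    using hofstadter_gap_small[of "exp (- r)"] unfolding eventually_sequentially by auto
  define C where "C = real (hofstadter (Suc m))"
  have "1 \<le> C" using hofstadter_ge_index[of "Suc m"] by (simp add: C_def)
  have "real (hofstadter (Suc k)) - real (hofstadter k) \<le> C * real (hofstadter k) powr (1 - s)"
    if "1 \<le> k" for k
    using that
  proof (induction k rule: less_induct)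
    case (less k)
    define x where "x = real (hofstadter k)"
    have "1 \<le> x" using hofstadter_ge_index[of k] less.prems by (simp add: x_def)
    have g: "real (hofstadter (Suc k)) \<le> 2 * x"
      using hofstadter_Suc_le_double[of k] less.prems by (simp add: x_def)
    have xs: "1 \<le> x powr (1 - s)" using \<open>1 \<le> x\<close> \<open>s < 1\<close> by (intro ge_one_powr_ge_zero) auto
    \<comment> \<open>For \<open>k <= m\<close> the constant \<open>C\<close> dominates a_k. Beyond
      that, the induction handles x^s > C e^r and the o(x) bound handles x^s <= C e^r.\<close>
    consider "k \<le> m" | "m < k" "ln C + r < s * ln x" | "m < k" "s * ln x \<le> ln C + r" by linarith
    then have "real (hofstadter (Suc k)) - x \<le> C * x powr (1 - s)"
    proof cases
      case 1
      then have "x \<le> C"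
        using hofstadter_mono[of k "Suc m"] less.prems by (simp add: x_def C_def)
      then show ?thesis using g xs mult_left_mono[OF xs, of C] \<open>1 \<le> C\<close> by linarith
    next
      case 2
      then have "2 \<le> k \<or> k = 1" using less.prems by linarith
      then have "2 \<le> k"
      proof
        assume "k = 1"
        moreover have "0 \<le> ln C" "0 < r" using \<open>1 \<le> C\<close> \<open>0 < d\<close> assms by (auto simp: r_def)
        ultimately show "2 \<le> k" using 2 by (simp add: x_def)
      qed
      obtain p q where pq: "p \<le> q" "q < k" "psum q \<le> hofstadter k" "psum p \<le> hofstadter (Suc q)"
        "hofstadter (Suc k) \<le> hofstadter k + hofstadter (Suc p)"
        using hofstadter_gap[OF \<open>2 \<le> k\<close>] .
      define u where "u = real (hofstadter (Suc q))"
      define v where "v = real (hofstadter (Suc p))"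
      have uv: "1 \<le> u" "1 \<le> v"
        using hofstadter_ge_index[of "Suc q"] hofstadter_ge_index[of "Suc p"] by (simp_all add: u_def v_def)
      \<comment> \<open>Since \<open>C * w >= 1\<close>, the additive 1 is absorbed and 4 becomes 5.
        The induction hypothesis applies because \<open>j <= q < k\<close>.\<close>
      have step: "(1 + s) * ln (real (hofstadter (Suc j))) \<le> ln 5 + ln C + ln w"
        if "j \<le> q" "real (psum j) \<le> w" "1 \<le> w" for j w
      proof -
        have j: "0 < real (hofstadter (Suc j))" using hofstadter_pos[of "Suc j"] by simp
        have "real (hofstadter (Suc j)) powr (1 + s) \<le> 4 * C * real (psum j) + 1"
          using less.IH that pq \<open>1 \<le> C\<close> assms \<open>s < 1\<close> by (intro psum_ge_powr) auto
        also have "\<dots> \<le> 4 * C * w + C * w"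
          using that \<open>1 \<le> C\<close> mult_mono[of 1 C 1 w] by (intro add_mono mult_left_mono) auto
        finally have "real (hofstadter (Suc j)) powr (1 + s) \<le> 5 * C * w" by simp
        then have "ln (real (hofstadter (Suc j)) powr (1 + s)) \<le> ln (5 * C * w)"
          using j that \<open>1 \<le> C\<close> by (subst ln_le_cancel_iff) auto
        then show ?thesis using j that \<open>1 \<le> C\<close> by (simp add: ln_powr ln_mult)
      qed
      have 1: "(1 + s) * ln u \<le> ln 5 + ln C + ln x"
        unfolding u_def using pq \<open>1 \<le> x\<close> by (intro step) (auto simp: x_def)
      have 3: "(1 + s) * ln v \<le> ln 5 + ln C + ln u"
        unfolding v_def using pq uv by (intro step) (auto simp: u_def)
      have "(1 + s) * ((1 + s) * ln v) \<le> (1 + s) * (ln 5 + ln C + ln u)"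
        using 3 assms by (intro mult_left_mono) auto
      also have "\<dots> \<le> (2 + s) * (ln 5 + ln C) + ln x"
        using 1 by (simp add: algebra_simps)
      \<comment> \<open>The coefficients match: d + (1 + s)^2 = 2 + s for ln C, and (1 + s)^2 (1 -
        s) - s d = 1 for ln x. The first summand is negative in this range.\<close>
      also have "\<dots> = d * (ln C + r - s * ln x) + (1 + s)\<^sup>2 * (ln C + (1 - s) * ln x)"
        using \<open>0 < d\<close> unfolding r_def by (simp add: field_simps) (simp add: d_def algebra_simps power2_eq_square)
      also have "\<dots> \<le> (1 + s)\<^sup>2 * (ln C + (1 - s) * ln x)"
        using 2 \<open>0 < d\<close> by (simp add: mult_nonneg_nonpos)
      finally have "(1 + s)\<^sup>2 * ln v \<le> (1 + s)\<^sup>2 * (ln C + (1 - s) * ln x)"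
        by (simp add: power2_eq_square mult.assoc)
      then have "ln v \<le> ln C + (1 - s) * ln x" using assms by simp
      also have "\<dots> = ln (C * x powr (1 - s))"
        using \<open>1 \<le> C\<close> \<open>1 \<le> x\<close> by (simp add: ln_mult ln_powr)
      finally have "v \<le> C * x powr (1 - s)"
        using uv \<open>1 \<le> C\<close> \<open>1 \<le> x\<close> by (subst (asm) ln_le_cancel_iff) auto
      then show ?thesis using pq(5) by (simp add: x_def v_def)
    next
      case 3
      have "real (hofstadter (Suc k)) - x \<le> exp (- r) * x"
        using m[of k] 3 by (simp add: x_def)
      also have "\<dots> = exp (ln x - r)" using \<open>1 \<le> x\<close> by (simp add: exp_diff exp_minus field_simps)
      also have "\<dots> \<le> exp (ln C + (1 - s) * ln x)" using 3 by (simp add: algebra_simps)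
      also have "\<dots> = C * x powr (1 - s)"
        using \<open>1 \<le> C\<close> \<open>1 \<le> x\<close> by (simp add: exp_add powr_def)
      finally show ?thesis .
    qed
    then show ?case by (simp add: x_def)
  qed
  then show ?thesis using that \<open>1 \<le> C\<close> by blast
qed

section \<open>From gaps to growth\<close>

text \<open>By the mean value theorem, the factor x^(1-s) of the gap cancels x^(s-1) from the
  derivative, so a_n^s grows by at most C per step.\<close>

theorem hofstadter_le_powr:
  fixes s :: real
  assumes "0 < s" "s + s\<^sup>2 < 1"
  obtains B where "0 < B" "\<And>n. 1 \<le> n \<Longrightarrow> real (hofstadter n) \<le> B * real n powr (1 / s)"
proof -
  have "s < 1" using assms zero_le_power2[of s] by linarith
  obtain C where C: "1 \<le> C" "\<And>k. 1 \<le> k \<Longrightarrow>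
    real (hofstadter (Suc k)) - real (hofstadter k) \<le> C * real (hofstadter k) powr (1 - s)"
    using hofstadter_gap_powr[OF assms] by blast
  have *: "real (hofstadter n) powr s \<le> C * real n" if "1 \<le> n" for n
    using that
  proof (induction n rule: dec_induct)
    case base
    then show ?case using C by simp
  next
    case (step n)
    define x where "x = real (hofstadter n)"
    define y where "y = real (hofstadter (Suc n))"
    have x: "0 < x" "x < y"
      using hofstadter_pos[of n] hofstadter_less_Suc[of n] step by (simp_all add: x_def y_def)
    have "\<exists>z>x. z < y \<and> y powr s - x powr s = (y - x) * (s * z powr (s - 1))"
      using x by (intro MVT2) (auto intro!: derivative_eq_intros)
    then obtain z where z: "x < z" "y powr s - x powr s = (y - x) * (s * z powr (s - 1))" by blast
    have "s * z powr (s - 1) \<le> 1 * x powr (s - 1)"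
      using x z assms \<open>s < 1\<close> by (intro mult_mono powr_mono2') auto
    then have "y powr s - x powr s \<le> (C * x powr (1 - s)) * x powr (s - 1)"
      unfolding z(2) using C step(1) x assms by (intro mult_mono) (auto simp: x_def y_def)
    also have "\<dots> = C" using x by (simp add: mult.assoc flip: powr_add)
    finally show ?case using step.IH by (simp add: x_def y_def algebra_simps)
  qed
  have "real (hofstadter n) \<le> C powr (1 / s) * real n powr (1 / s)" if "1 \<le> n" for n
  proof -
    have "(real (hofstadter n) powr s) powr (1 / s) \<le> (C * real n) powr (1 / s)"
      using *[OF that] assms by (intro powr_mono2) auto
    then show ?thesis using assms C by (simp add: powr_powr powr_mult)
  qed
  then show ?thesis using that[of "C powr (1 / s)"] C by simp
qed

theorem theorem1p5:
  fixes \<epsilon> :: real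
  assumes "\<epsilon> > 0"
  shows "\<exists>C::real. C > 0 \<and>
    (\<forall>n::nat. n \<ge> 1 \<longrightarrow> real (hofstadter n) \<le> C * real n powr (4175 / 2506 + \<epsilon>))"
proof -
  \<comment> \<open>Here s is the reciprocal of the target exponent, and s + s^2 is about
    0.96.\<close>
  obtain B where B: "0 < B" "\<And>n. 1 \<le> n \<Longrightarrow> real (hofstadter n) \<le> B * real n powr (4175 / 2506)"
    using hofstadter_le_powr[of "2506 / 4175"] by (auto simp: power2_eq_square)
  have "real (hofstadter n) \<le> B * real n powr (4175 / 2506 + \<epsilon>)" if "1 \<le> n" for n
  proof -
    have "real n powr (4175 / 2506) \<le> real n powr (4175 / 2506 + \<epsilon>)"
      using that assms by (intro powr_mono) auto
    then have "B * real n powr (4175 / 2506) \<le> B * real n powr (4175 / 2506 + \<epsilon>)"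
      using B(1) by (intro mult_left_mono) auto
    then show ?thesis using B(2)[OF that] by linarith
  qed
  then show ?thesis using B(1) by blast
qed

end
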